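(* Let $n\ge 1$, let $U\subset\mathbb{R}^{n+1}$ and $V\subset\mathbb{R}^n$ be open sets, let $p_0\in U$, $t_0\in\mathbb{R}$, let $F:U\to\mathbb{R}^{n+1}$ be a continuous function, and let $\{g_s:V\to U\}_{s\in J}$ be a local $n$-foliation of $U$ at $p_0$, with associated diffeomorphism $\Phi:J\times V\to U$, $\Phi(s,y)=g_s(y)$. Write $\Phi^{-1}_1$ for the first component of $\Phi^{-1}:U\to J\times V\subset\mathbb{R}^{n+1}$. Assume: (C1) (transversality condition) $$\left\langle\left(\frac{\partial\Phi_1^{-1}}{\partial z_1}(p_0),\dots,\frac{\partial\Phi_1^{-1}}{\partial z_{n+1}}(p_0)\right),F(p_0)\right\rangle\neq 0;$$ (C2) (Lipschitz condition along the foliation) $F\circ\Phi$ and $(\Phi')^{-1}$ are Lipschitz in a neighborhood of zero when fixing the first variable. Then there exists $\alpha>0$ such that the initial value problem $$z'(t)=F(z(t)),\qquad z(t_0)=p_0,$$ has a unique solution in $[t_0-\alpha,t_0+\alpha]$.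
   Context: Local $n$-foliation: let $p_0\in\mathbb{R}^{n+1}$. Suppose there are open sets $V\subset\mathbb{R}^n$, $U\subset\mathbb{R}^{n+1}$, an open interval $J\subset\mathbb{R}$ with $0\in J$, and a family of differentiable functions $\{g_s:V\to U\}_{s\in J}$ such that $g_0(0)=p_0\in U$ (so in particular $0\in V$) and $\Phi:J\times V\to U$, $\Phi(s,y)=g_s(y)$, is a diffeomorphism. Then $\{g_s\}_{s\in J}$ is called a local $n$-foliation of $U$ at $p_0$. Diffeomorphism means a $C^1$ bijection with $C^1$ inverse. $\Phi'$ denotes the derivative (Jacobian matrix) of $\Phi$, and $(\Phi')^{-1}$ denotes the function $x\mapsto(\Phi'(x))^{-1}$ (matrix inverse), defined on $J\times V$. Lipschitz when fixing the first variable: if $g:D\subset\mathbb{R}^{n+1}\to E$ with $E$ a normed space, $g$ is Lipschitz in $D$ when fixing the first variable if there exists $L>0$ such that for all $(s,x_1,\dots,x_n),(s,y_1,\dots,y_n)\in D$, $$\|g(s,x_1,\dots,x_n)-g(s,y_1,\dots,y_n)\|_E\le L\,\|(x_1,\dots,x_n)-(y_1,\dots,y_n)\|.$$ Here matrices carry the usual matrix norm (any choice of norms is equivalent). $\langle\cdot,\cdot\rangle$ is the Euclidean scalar product. *)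

theory Defs
  imports "HOL-Analysis.Analysis"
begin

text \<open>
  The Euclidean space containing \<open>U\<close> is \<^typ>\<open>real^'m\<close> with \<open>CARD('m) = CARD('n) + 1\<close>.
  The one containing \<open>J \<times> V\<close> is \<^typ>\<open>real \<times> (real^'n)\<close>, the splitting \<open>\<real> \<times> \<real>\<^sup>n\<close> of
  \<open>\<real>\<^sup>n\<^sup>+\<^sup>1\<close> into the first variable and the remaining ones, whose norm and inner product are
  again the Euclidean ones. Matrices with \<open>n + 1\<close> columns indexed by these coordinates use
  the index type \<^typ>\<open>'n option\<close>, with \<^term>\<open>None\<close> for the first variable.
\<close>

text \<open>Continuous differentiability, meant for open \<open>S\<close>.\<close>

definition C1_on :: "'a::real_normed_vector set \<Rightarrow> ('a \<Rightarrow> 'b::real_normed_vector) \<Rightarrow> bool" where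
  "C1_on S f \<longleftrightarrow>
     (\<exists>f'. (\<forall>x\<in>S. (f has_derivative blinfun_apply (f' x)) (at x)) \<and> continuous_on S f')"

definition C1_diffeomorphism ::
  "'a::real_normed_vector set \<Rightarrow> 'b::real_normed_vector set \<Rightarrow> ('a \<Rightarrow> 'b) \<Rightarrow> bool" where
  "C1_diffeomorphism S T f \<longleftrightarrow> bij_betw f S T \<and> C1_on S f \<and> C1_on T (inv_into S f)"

definition foliation_map :: "(real \<Rightarrow> 'a \<Rightarrow> 'b) \<Rightarrow> real \<times> 'a \<Rightarrow> 'b" where
  "foliation_map g = (\<lambda>(s, y). g s y)"

definition local_foliation ::
  "(real \<Rightarrow> real^'n \<Rightarrow> real^'m) \<Rightarrow> real set \<Rightarrow> (real^'n) set \<Rightarrow> (real^'m) set \<Rightarrow> real^'m \<Rightarrow> bool" where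
  "local_foliation g J V U p0 \<longleftrightarrow>
     CARD('m) = CARD('n) + 1 \<and>
     open V \<and> open U \<and> open J \<and> is_interval J \<and> 0 \<in> J \<and>
     (\<forall>s\<in>J. g s ` V \<subseteq> U \<and> g s differentiable_on V) \<and>
     0 \<in> V \<and> p0 \<in> U \<and> g 0 0 = p0 \<and>
     C1_diffeomorphism (J \<times> V) U (foliation_map g)"

text \<open>The vector of partial derivatives.\<close>

definition gradient :: "(real^'m \<Rightarrow> real) \<Rightarrow> real^'m \<Rightarrow> real^'m" where
  "gradient f p = (\<chi> i. deriv (\<lambda>h. f (p + h *\<^sub>R axis i 1)) 0)"

fun std_basis :: "'n option \<Rightarrow> real \<times> (real^'n)" where
  "std_basis None = (1, 0)"
| "std_basis (Some j) = (0, axis j 1)"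

text \<open>The library constant \<^const>\<open>jacobian\<close> does not apply to the domain \<^typ>\<open>real \<times> (real^'n)\<close>.\<close>

definition jacobian_matrix ::
  "(real \<times> (real^'n) \<Rightarrow> real^'m) \<Rightarrow> real \<times> (real^'n) \<Rightarrow> real^('n option)^'m" where
  "jacobian_matrix f x = (\<chi> i j. frechet_derivative f (at x) (std_basis j) $ i)"

definition lipschitz_fixing_first ::
  "('s \<times> 'a::real_normed_vector) set \<Rightarrow> ('s \<times> 'a \<Rightarrow> 'e::real_normed_vector) \<Rightarrow> bool" where
  "lipschitz_fixing_first D f \<longleftrightarrow>
     (\<exists>L>0. \<forall>s x y. (s, x) \<in> D \<longrightarrow> (s, y) \<in> D \<longrightarrow> norm (f (s, x) - f (s, y)) \<le> L * norm (x - y))"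

text \<open>The set \<open>D\<close> is the domain of \<open>f\<close>. For matrix-valued \<open>f\<close> the norm is the Frobenius norm.\<close>

definition lipschitz_fixing_first_near_zero ::
  "(real \<times> 'a::real_normed_vector) set \<Rightarrow> (real \<times> 'a \<Rightarrow> 'e::real_normed_vector) \<Rightarrow> bool" where
  "lipschitz_fixing_first_near_zero D f \<longleftrightarrow>
     (\<exists>N. open N \<and> 0 \<in> N \<and> N \<subseteq> D \<and> lipschitz_fixing_first N f)"

definition ivp_solution ::
  "('a::real_normed_vector \<Rightarrow> 'a) \<Rightarrow> 'a set \<Rightarrow> real \<Rightarrow> 'a \<Rightarrow> real set \<Rightarrow> (real \<Rightarrow> 'a) \<Rightarrow> bool" where
  "ivp_solution F U t0 p0 I z \<longleftrightarrow>
     z t0 = p0 \<and> (\<forall>t\<in>I. z t \<in> U \<and> (z has_vector_derivative F (z t)) (at t within I))"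

text \<open>Uniqueness refers to the values on \<open>I\<close> only, since HOL functions are total.\<close>

definition has_unique_ivp_solution ::
  "('a::real_normed_vector \<Rightarrow> 'a) \<Rightarrow> 'a set \<Rightarrow> real \<Rightarrow> 'a \<Rightarrow> real set \<Rightarrow> bool" where
  "has_unique_ivp_solution F U t0 p0 I \<longleftrightarrow>
     (\<exists>z. ivp_solution F U t0 p0 I z \<and>
          (\<forall>w. ivp_solution F U t0 p0 I w \<longrightarrow> (\<forall>t\<in>I. w t = z t)))"

end

theory Submission
  imports Defs
begin

text \<open>
  In the coordinates \<open>x = \<Phi>\<^sup>-\<^sup>1(z)\<close> the equation reads \<open>x' = G(x)\<close> with
  \<open>G = (\<Phi>')\<^sup>-\<^sup>1 (F \<circ> \<Phi>)\<close>, which is Lipschitz near zero when the first variable is fixed;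
  transversality says that the first component \<open>G\<^sub>1\<close> does not vanish at zero.  Hence the
  first coordinate \<open>s\<close> can replace time: \<open>Y' = G\<^sub>2(s, Y) / G\<^sub>1(s, Y)\<close> is covered by Picard's
  theorem, and what remains is the scalar equation \<open>s' = G\<^sub>1(s, Y(s))\<close>, for which a continuous
  nonvanishing right-hand side suffices.
\<close>

text \<open>The hypotheses say nothing about how G varies with its first variable beyond continuity,
  so Picard's theorem cannot be applied to x' = G(x) itself. Making that variable the independent
  one helps because Picard's theorem asks only for continuity there. Continuity of G needs an
  argument of its own: the inverse of the Jacobian of \<Phi> at x is the matrix of the derivative of
  the inverse map at \<Phi>(x), and that derivative is continuous because \<Phi> is a diffeomorphism
  of class C^1. The Lipschitz bound and the lower bound on the first component hold only near zero,
  whereas a competing solution may a priori take values anywhere in U. A bound on the speed near the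
  initial point gives one interval length on which every solution is confined, and only then are
  solutions compared.\<close>

section \<open>Linear algebra in coordinates indexed by \<open>'n option\<close>\<close>

lemma sum_UNIV_option:
  fixes f :: "'n::finite option \<Rightarrow> 'a::comm_monoid_add"
  shows "(\<Sum>j\<in>UNIV. f j) = f None + (\<Sum>i\<in>UNIV. f (Some i))"
  by (simp add: UNIV_option_conv sum.reindex)

lemma inner_std_basis: "std_basis i \<bullet> std_basis j = (if i = j then 1 else 0)"
  by (cases i; cases j) (auto simp: inner_axis_axis)

lemma std_basis_expansion:
  fixes x :: "real \<times> (real^'n)"
  shows "(\<Sum>j\<in>UNIV. (x \<bullet> std_basis j) *\<^sub>R std_basis j) = x"
proof -
  have "(\<Sum>i\<in>UNIV. snd x $ i *\<^sub>R (0, axis i 1)) = (0::real, \<Sum>i\<in>UNIV. snd x $ i *\<^sub>R (axis i 1 :: real^'n))"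
    by (simp add: prod_eq_iff fst_sum snd_sum)
  then show ?thesis
    using basis_expansion[of "snd x"]
    by (cases x) (simp add: sum_UNIV_option inner_axis scalar_mult_eq_scaleR)
qed

lemma linear_std_basis_expansion:
  fixes f :: "real \<times> (real^'n) \<Rightarrow> 'a::real_vector"
  assumes "linear f"
  shows "(\<Sum>j\<in>UNIV. (x \<bullet> std_basis j) *\<^sub>R f (std_basis j)) = f x"
  using arg_cong[OF std_basis_expansion[of x], of f]
  by (simp add: linear_sum[OF assms] linear_cmul[OF assms])

lemma linear_axis_expansion:
  fixes f :: "real^'m \<Rightarrow> 'a::real_vector"
  assumes "linear f"
  shows "(\<Sum>i\<in>UNIV. (x $ i) *\<^sub>R f (axis i 1)) = f x"
  using arg_cong[OF basis_expansion[of x], of f]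
  by (simp add: linear_sum[OF assms] linear_cmul[OF assms] scalar_mult_eq_scaleR)

text \<open>\<open>matrix_inv\<close> is a chosen two-sided inverse, and two-sided inverses are
  unique. The row and column types differ, so both products have to be supplied.\<close>

lemma matrix_inv_eqI:
  fixes A :: "real^'n^'m"
  assumes "A ** B = mat 1" "B ** A = mat 1"
  shows "matrix_inv A = B"
proof -
  have "A ** matrix_inv A = mat 1 \<and> matrix_inv A ** A = mat 1"
    unfolding matrix_inv_def by (rule someI[of _ B]) (use assms in simp)
  then show ?thesis
    using assms by (metis matrix_mul_assoc matrix_mul_lid matrix_mul_rid)
qed

text \<open>The inverse Jacobian produces coordinate columns over \<open>'n option\<close>; this
  reads them as vectors of the space that contains J \<times> V.\<close>

definition std_vector :: "real^('n option) \<Rightarrow> real \<times> (real^'n)" where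
  "std_vector u = (\<Sum>j\<in>UNIV. (u $ j) *\<^sub>R std_basis j)"

lemma linear_std_vector: "linear std_vector"
  unfolding std_vector_def by (rule linearI) (simp_all add: scaleR_add_left sum.distrib scaleR_sum_right)

text \<open>Presents G as a bounded bilinear product of the inverse Jacobian and F \<circ> \<Phi>,
  so that continuity and the Lipschitz condition pass from the factors to G.\<close>

lemma bounded_bilinear_std_vector_mult:
  "bounded_bilinear (\<lambda>A (v::real^'m). std_vector (A *v v))"
proof -
  have "bilinear (\<lambda>A (v::real^'m). std_vector (A *v v))"
    unfolding bilinear_def
    by (auto intro!: linearI simp: matrix_vector_mult_add_rdistrib matrix_vector_right_distrib
        linear_add[OF linear_std_vector] linear_cmul[OF linear_std_vector] scaleR_matrix_vector_assoc[symmetric]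
        matrix_vector_mult_scaleR)
  then show ?thesis by (simp add: bilinear_conv_bounded_bilinear)
qed

text \<open>Mutually inverse linear maps have mutually inverse matrices. With \<open>h'\<close> the
  derivative of the inverse map, this translates the hypothesis on inverse matrices into a statement
  about derivatives.\<close>

lemma matrix_inv_jacobian_matrix:
  fixes f :: "real \<times> (real^'n) \<Rightarrow> real^'m"
  assumes f': "(f has_derivative f') (at x)" and "linear h'"
    and "\<And>v. h' (f' v) = v" "\<And>v. f' (h' v) = v"
  shows "matrix_inv (jacobian_matrix f x) = (\<chi> j i. h' (axis i 1) \<bullet> std_basis j)" (is "_ = ?B")
    and "std_vector (matrix_inv (jacobian_matrix f x) *v v) = h' v"
proof -
  have lin: "linear f'" using f' has_derivative_linear by blast
  define A where "A = jacobian_matrix f x"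
  have A: "A = (\<chi> i j. f' (std_basis j) $ i)"
    unfolding A_def jacobian_matrix_def frechet_derivative_at[OF f', symmetric] ..
  \<comment> \<open>Expanding the argument in the basis turns an entry of either matrix product into
    a coordinate of one map applied to the other; \<open>comp\<close> and \<open>h'_inner\<close>
    serve the two orders of multiplication.\<close>
  have comp: "(\<Sum>j\<in>UNIV. (y \<bullet> std_basis j) * (f' (std_basis j) $ i)) = f' y $ i" for y i
    using arg_cong[OF linear_std_basis_expansion[OF lin, of y], of "\<lambda>v. v $ i"] by simp
  have h'_inner: "(\<Sum>i\<in>UNIV. (u $ i) * (h' (axis i 1) \<bullet> std_basis j)) = h' u \<bullet> std_basis j" for u j
    using arg_cong[OF linear_axis_expansion[OF \<open>linear h'\<close>, of u], of "\<lambda>v. v \<bullet> std_basis j"]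
    by (simp add: inner_sum_left)
  have "A ** ?B = mat 1"
    using comp[of "h' (axis _ 1)"] assms(4)
    by (simp add: A vec_eq_iff matrix_matrix_mult_def mat_def axis_def mult.commute[of "f' _ $ _"])
  moreover have "?B ** A = mat 1"
    using h'_inner[of "f' (std_basis _)"] assms(3)
    by (simp add: A vec_eq_iff matrix_matrix_mult_def mat_def inner_std_basis mult.commute[of "h' _ \<bullet> _"])
  ultimately show inv: "matrix_inv (jacobian_matrix f x) = ?B"
    unfolding A_def by (rule matrix_inv_eqI)
  have "?B *v v = (\<chi> j. h' v \<bullet> std_basis j)"
    using h'_inner[of v]
    by (simp add: vec_eq_iff matrix_vector_mult_def mult.commute[of "h' _ \<bullet> _"])
  then show "std_vector (matrix_inv (jacobian_matrix f x) *v v) = h' v"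
    using std_basis_expansion[of "h' v"] by (simp add: inv std_vector_def)
qed

section \<open>Derivatives of the diffeomorphism and transport of solutions\<close>

text \<open>The chain rule for h \<circ> f = id near x, with uniqueness of derivatives at interior
  points. Used with both orders of the two maps, it makes their derivatives mutually
  inverse.\<close>

lemma left_inverse_derivative:
  assumes "open S" "x \<in> S" and "\<And>y. y \<in> S \<Longrightarrow> h (f y) = y"
    and "(f has_derivative f') (at x)" "(h has_derivative h') (at (f x))"
  shows "h' (f' v) = v"
proof -
  have "(h \<circ> f has_derivative h' \<circ> f') (at x)" by (rule diff_chain_at) fact+
  then have "((\<lambda>y. y) has_derivative h' \<circ> f') (at x)"
    by (rule has_derivative_transform_within_open[OF _ assms(1,2)]) (simp add: assms(3))
  then have "h' \<circ> f' = (\<lambda>y. y)" using has_derivative_unique has_derivative_ident by blast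
  then show ?thesis by (metis comp_apply)
qed

text \<open>Turns the transversality condition, stated with partial derivatives, into a statement
  about the first component of G at zero.\<close>

lemma gradient_inner:
  fixes f :: "real^'m \<Rightarrow> real"
  assumes f': "(f has_derivative f') (at p)"
  shows "gradient f p \<bullet> v = f' v"
proof -
  have "((\<lambda>h. f (p + h *\<^sub>R axis i 1)) has_real_derivative f' (axis i 1)) (at 0)" for i
  proof -
    have "((\<lambda>h::real. p + h *\<^sub>R axis i 1) has_derivative (\<lambda>h. h *\<^sub>R axis i 1)) (at 0)"
      by (auto intro!: derivative_eq_intros)
    from has_derivative_compose[OF this, of f f'] f'
    have "((\<lambda>h. f (p + h *\<^sub>R axis i 1)) has_derivative (\<lambda>h. f' (h *\<^sub>R axis i 1))) (at 0)" by simp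
    then show ?thesis
      by (simp add: has_field_derivative_def linear_cmul[OF has_derivative_linear[OF f']] mult.commute[of _ "f' _"])
  qed
  then have "gradient f p $ i = f' (axis i 1)" for i
    unfolding gradient_def by (simp add: DERIV_imp_deriv)
  then show ?thesis
    using linear_axis_expansion[OF has_derivative_linear[OF f'], of v]
    by (simp add: inner_vec_def mult.commute)
qed

text \<open>The chain rule needs only that \<open>\<psi>'\<close> maps \<open>F\<close> to
  \<open>G\<close>. The same fact therefore moves solutions along \<Phi> for existence and along its
  inverse for uniqueness.\<close>

lemma ivp_solution_diffeomorphism:
  assumes z: "ivp_solution F U t0 p0 I z"
    and \<psi>': "\<And>p. p \<in> U \<Longrightarrow> (\<psi> has_derivative \<psi>' p) (at p)"
    and "\<And>p. p \<in> U \<Longrightarrow> \<psi> p \<in> W"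
    and "\<And>p. p \<in> U \<Longrightarrow> G (\<psi> p) = \<psi>' p (F p)"
  shows "ivp_solution G W t0 (\<psi> p0) I (\<psi> \<circ> z)"
  unfolding ivp_solution_def
proof (intro conjI ballI)
  show "(\<psi> \<circ> z) t0 = \<psi> p0" using z by (simp add: ivp_solution_def)
  fix t assume "t \<in> I"
  then have zt: "z t \<in> U" "(z has_vector_derivative F (z t)) (at t within I)"
    using z by (auto simp: ivp_solution_def)
  show "(\<psi> \<circ> z) t \<in> W" using zt assms(3) by simp
  have "(\<psi> \<circ> z has_vector_derivative \<psi>' (z t) (F (z t))) (at t within I)"
    by (rule vector_derivative_diff_chain_within[OF zt(2) has_derivative_at_withinI[OF \<psi>'[OF zt(1)]]])
  then show "(\<psi> \<circ> z has_vector_derivative G ((\<psi> \<circ> z) t)) (at t within I)"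
    using assms(4)[OF zt(1)] by simp
qed

section \<open>Closure properties of the Lipschitz condition with fixed first variable\<close>

lemma lipschitz_fixing_first_subset:
  "lipschitz_fixing_first D f \<Longrightarrow> D' \<subseteq> D \<Longrightarrow> lipschitz_fixing_first D' f"
  unfolding lipschitz_fixing_first_def by (meson subsetD)

lemma lipschitz_fixing_first_linear:
  assumes "lipschitz_fixing_first D f" "bounded_linear h"
  shows "lipschitz_fixing_first D (\<lambda>x. h (f x))"
proof -
  obtain L where L: "L > 0" "\<And>s x y. (s, x) \<in> D \<Longrightarrow> (s, y) \<in> D \<Longrightarrow> norm (f (s, x) - f (s, y)) \<le> L * norm (x - y)"
    using assms(1) unfolding lipschitz_fixing_first_def by metis
  obtain K where K: "K > 0" "\<And>x. norm (h x) \<le> norm x * K"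
    using bounded_linear.pos_bounded[OF assms(2)] by blast
  have "norm (h (f (s, x)) - h (f (s, y))) \<le> (L * K) * norm (x - y)" if "(s, x) \<in> D" "(s, y) \<in> D" for s x y
  proof -
    have "norm (h (f (s, x)) - h (f (s, y))) \<le> norm (f (s, x) - f (s, y)) * K"
      using K(2)[of "f (s, x) - f (s, y)"] by (simp add: linear_diff[OF bounded_linear.linear[OF assms(2)]])
    also have "\<dots> \<le> (L * norm (x - y)) * K" using L(2)[OF that] K by (intro mult_right_mono) auto
    finally show ?thesis by (simp add: ac_simps)
  qed
  then show ?thesis
    using L(1) K(1) unfolding lipschitz_fixing_first_def by (intro exI[of _ "L * K"]) auto
qed

text \<open>A difference of products is split by changing one factor at a time; the bound
  \<open>M\<close> controls the factor left unchanged.\<close>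

lemma lipschitz_fixing_first_bilinear:
  assumes "bounded_bilinear p"
    and "lipschitz_fixing_first D f" "lipschitz_fixing_first D g"
    and "\<And>x. x \<in> D \<Longrightarrow> norm (f x) \<le> M" "\<And>x. x \<in> D \<Longrightarrow> norm (g x) \<le> M"
  shows "lipschitz_fixing_first D (\<lambda>x. p (f x) (g x))"
proof -
  interpret bounded_bilinear p by fact
  obtain Lf where Lf: "Lf > 0" "\<And>s x y. (s, x) \<in> D \<Longrightarrow> (s, y) \<in> D \<Longrightarrow> norm (f (s, x) - f (s, y)) \<le> Lf * norm (x - y)"
    using assms(2) unfolding lipschitz_fixing_first_def by metis
  obtain Lg where Lg: "Lg > 0" "\<And>s x y. (s, x) \<in> D \<Longrightarrow> (s, y) \<in> D \<Longrightarrow> norm (g (s, x) - g (s, y)) \<le> Lg * norm (x - y)"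
    using assms(3) unfolding lipschitz_fixing_first_def by metis
  obtain K where K: "K > 0" "\<And>a b. norm (p a b) \<le> norm a * norm b * K"
    using pos_bounded by blast
  \<comment> \<open>\<open>\<bar>M\<bar> + 1\<close> in place of \<open>M\<close> keeps the constant
    positive whatever \<open>M\<close> is.\<close>
  define C where "C = (Lf + Lg) * (\<bar>M\<bar> + 1) * K"
  have "norm (p (f (s, x)) (g (s, x)) - p (f (s, y)) (g (s, y))) \<le> C * norm (x - y)"
    if xy: "(s, x) \<in> D" "(s, y) \<in> D" for s x y
  proof -
    let ?f = "f (s, x)" and ?f' = "f (s, y)" and ?g = "g (s, x)" and ?g' = "g (s, y)"
    have M: "norm ?f' \<le> \<bar>M\<bar> + 1" "norm ?g \<le> \<bar>M\<bar> + 1"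
      using assms(4)[OF xy(2)] assms(5)[OF xy(1)] by auto
    have "p ?f ?g - p ?f' ?g' = p (?f - ?f') ?g + p ?f' (?g - ?g')"
      by (simp add: diff_left diff_right)
    then have "norm (p ?f ?g - p ?f' ?g') \<le> norm (p (?f - ?f') ?g) + norm (p ?f' (?g - ?g'))"
      by (simp add: norm_triangle_ineq)
    also have "\<dots> \<le> norm (?f - ?f') * norm ?g * K + norm ?f' * norm (?g - ?g') * K"
      by (intro add_mono K)
    also have "\<dots> \<le> (Lf * norm (x - y)) * (\<bar>M\<bar> + 1) * K + (\<bar>M\<bar> + 1) * (Lg * norm (x - y)) * K"
      by (intro add_mono mult_mono Lf(2) Lg(2) M xy norm_ge_zero mult_nonneg_nonneg)
         (simp_all add: less_imp_le[OF Lf(1)] less_imp_le[OF Lg(1)] less_imp_le[OF K(1)])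
    finally show ?thesis by (simp add: C_def algebra_simps)
  qed
  moreover have "C > 0" unfolding C_def using Lf(1) Lg(1) K(1) by (intro mult_pos_pos) auto
  ultimately show ?thesis unfolding lipschitz_fixing_first_def by blast
qed

text \<open>From 1/p - 1/q = (q - p)/(pq), the denominator being at least c^2 in absolute
  value.\<close>

lemma lipschitz_fixing_first_inverse:
  fixes f :: "'s \<times> 'a::real_normed_vector \<Rightarrow> real"
  assumes "lipschitz_fixing_first D f" and c: "c > 0" "\<And>x. x \<in> D \<Longrightarrow> c \<le> \<bar>f x\<bar>"
  shows "lipschitz_fixing_first D (\<lambda>x. inverse (f x))"
proof -
  obtain L where L: "L > 0" "\<And>s x y. (s, x) \<in> D \<Longrightarrow> (s, y) \<in> D \<Longrightarrow> norm (f (s, x) - f (s, y)) \<le> L * norm (x - y)"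
    using assms(1) unfolding lipschitz_fixing_first_def by metis
  have "norm (inverse (f (s, x)) - inverse (f (s, y))) \<le> L / c\<^sup>2 * norm (x - y)"
    if xy: "(s, x) \<in> D" "(s, y) \<in> D" for s x y
  proof -
    let ?p = "f (s, x)" and ?q = "f (s, y)"
    have pq: "c \<le> \<bar>?p\<bar>" "c \<le> \<bar>?q\<bar>" using c xy by auto
    then have "?p \<noteq> 0" "?q \<noteq> 0" using c(1) by auto
    then have "norm (inverse ?p - inverse ?q) = \<bar>?p - ?q\<bar> / (\<bar>?p\<bar> * \<bar>?q\<bar>)"
      by (simp add: inverse_diff_inverse abs_mult divide_simps)
    also have "\<dots> \<le> (L * norm (x - y)) / (c * c)"
    proof (rule frac_le)
      show "\<bar>?p - ?q\<bar> \<le> L * norm (x - y)" using L(2)[OF xy] by simp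
      show "c * c \<le> \<bar>?p\<bar> * \<bar>?q\<bar>" using pq c(1) by (intro mult_mono) simp_all
    qed (use L(1) c(1) in simp_all)
    finally show ?thesis by (simp add: power2_eq_square)
  qed
  moreover have "L / c\<^sup>2 > 0" using L(1) c(1) by simp
  ultimately show ?thesis unfolding lipschitz_fixing_first_def by blast
qed

text \<open>Continuity provides the bounds demanded by the product rule, at the price of a smaller
  neighbourhood.\<close>

lemma lipschitz_fixing_first_near_zero_bilinear:
  assumes "bounded_bilinear p" "open D"
    and f: "continuous_on D f" "lipschitz_fixing_first_near_zero D f"
    and g: "continuous_on D g" "lipschitz_fixing_first_near_zero D g"
  shows "lipschitz_fixing_first_near_zero D (\<lambda>x. p (f x) (g x))"
proof -
  obtain Nf where Nf: "open Nf" "0 \<in> Nf" "Nf \<subseteq> D" "lipschitz_fixing_first Nf f"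
    using f(2) unfolding lipschitz_fixing_first_near_zero_def by blast
  obtain Ng where Ng: "open Ng" "0 \<in> Ng" "Ng \<subseteq> D" "lipschitz_fixing_first Ng g"
    using g(2) unfolding lipschitz_fixing_first_near_zero_def by blast
  define M where "M = max (norm (f 0)) (norm (g 0)) + 1"
  define N where "N = Nf \<inter> Ng \<inter> (f -` ball 0 M \<inter> D) \<inter> (g -` ball 0 M \<inter> D)"
  have "open N"
    unfolding N_def Int_commute[of _ D]
    by (intro open_Int continuous_open_preimage Nf(1) Ng(1) f(1) g(1) \<open>open D\<close> open_ball)
  moreover have "0 \<in> N" "N \<subseteq> D" using Nf Ng by (auto simp: N_def M_def)
  moreover have "lipschitz_fixing_first N (\<lambda>x. p (f x) (g x))"
    by (rule lipschitz_fixing_first_bilinear[OF assms(1), where M = M])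
       (auto simp: N_def intro: lipschitz_fixing_first_subset[OF Nf(4)] lipschitz_fixing_first_subset[OF Ng(4)])
  ultimately show ?thesis unfolding lipschitz_fixing_first_near_zero_def by blast
qed

section \<open>Estimates for solutions on an interval\<close>

lemma vector_differentiable_bound:
  fixes f :: "real \<Rightarrow> 'a::real_normed_vector"
  assumes "convex S"
    and "\<And>x. x \<in> S \<Longrightarrow> (f has_vector_derivative f' x) (at x within S)"
    and "\<And>x. x \<in> S \<Longrightarrow> norm (f' x) \<le> B"
    and "x \<in> S" "y \<in> S"
  shows "norm (f x - f y) \<le> B * norm (x - y)"
proof (rule differentiable_bound[OF assms(1)])
  show "(f has_derivative (\<lambda>h. h *\<^sub>R f' z)) (at z within S)" if "z \<in> S" for z
    using assms(2)[OF that] by (simp add: has_vector_derivative_def)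
  show "onorm (\<lambda>h. h *\<^sub>R f' z) \<le> B" if "z \<in> S" for z
    by (rule onorm_le) (use assms(3)[OF that] in \<open>simp add: mult.commute[of B] mult_left_mono\<close>)
qed (use assms in auto)

lemma real_Icc_mvt_within:
  fixes v :: "real \<Rightarrow> real"
  assumes "a < b" and "{a..b} \<subseteq> I"
    and "\<And>t. t \<in> I \<Longrightarrow> (v has_real_derivative v' t) (at t within I)"
  obtains x where "x \<in> {a<..<b}" "v b - v a = v' x * (b - a)"
proof -
  have "\<exists>x\<in>{a<..<b}. v b - v a = (*) (v' x) (b - a)"
    by (rule mvt_simple[OF assms(1)])
       (use assms(2,3) in \<open>auto simp: has_field_derivative_def subset_iff intro: has_derivative_subset[OF _ assms(2)]\<close>)
  then show ?thesis using that by auto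
qed

text \<open>The squared norm of \<open>u\<close> times a suitable exponential weight is monotone,
  vanishes at \<open>t0\<close> and is nonnegative, so it is zero.\<close>

lemma gronwall_zero:
  fixes u :: "real \<Rightarrow> 'a::real_inner"
  assumes I: "is_interval I" "t0 \<in> I" "t \<in> I"
    and der: "\<And>t. t \<in> I \<Longrightarrow> (u has_vector_derivative u' t) (at t within I)"
    and bound: "\<And>t. t \<in> I \<Longrightarrow> norm (u' t) \<le> C * norm (u t)"
    and u0: "u t0 = 0"
  shows "u t = 0"
proof -
  define v where "v k t = (u t \<bullet> u t) * exp (k * t)" for k t
  define dv where "dv k t = (2 * (u t \<bullet> u' t) + k * (u t \<bullet> u t)) * exp (k * t)" for k t
  have v': "(v k has_real_derivative dv k t) (at t within I)"
    if "t \<in> I" for k t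
  proof -
    have "((\<lambda>t. u t \<bullet> u t) has_real_derivative 2 * (u t \<bullet> u' t)) (at t within I)"
      using der[OF that] unfolding has_vector_derivative_def has_field_derivative_def
      by (auto intro!: derivative_eq_intros simp: inner_commute)
    then show ?thesis
      unfolding v_def dv_def by (auto intro!: derivative_eq_intros simp: algebra_simps)
  qed
  have inner_bound: "\<bar>u t \<bullet> u' t\<bar> \<le> C * (u t \<bullet> u t)" if "t \<in> I" for t
  proof -
    have "\<bar>u t \<bullet> u' t\<bar> \<le> norm (u t) * norm (u' t)" by (rule Cauchy_Schwarz_ineq2)
    also have "\<dots> \<le> norm (u t) * (C * norm (u t))"
      using bound[OF that] by (simp add: mult_left_mono)
    finally show ?thesis by (simp add: dot_square_norm power2_eq_square algebra_simps)
  qed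
  have sub: "{a..b} \<subseteq> I" if "a \<in> I" "b \<in> I" for a b
    using I(1) that unfolding is_interval_1 atLeastAtMost_iff subset_iff by blast
  have v0: "v k t0 = 0" for k using u0 by (simp add: v_def)
  \<comment> \<open>The bound on \<open>u \<bullet> u'\<close> makes the weighted square
    nonincreasing for k = -2C and nondecreasing for k = 2C; the first serves times after
    \<open>t0\<close>, the second times before.\<close>
  consider "t = t0" | "t0 < t" | "t < t0" by linarith
  then have "\<exists>k. v k t \<le> 0"
  proof cases
    case 1
    then show ?thesis using v0 by auto
  next
    case 2
    obtain x where x: "x \<in> {t0<..<t}" "v (-2*C) t - v (-2*C) t0 = dv (-2*C) x * (t - t0)"
      using real_Icc_mvt_within[OF 2 sub[OF I(2,3)] v'] .
    have "x \<in> I" using x(1) sub[OF I(2,3)] by auto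
    then have "2 * (u x \<bullet> u' x) + (-2*C) * (u x \<bullet> u x) \<le> 0"
      using inner_bound[of x] by simp
    then have "v (-2*C) t - v (-2*C) t0 \<le> 0"
      unfolding x(2) dv_def using 2 by (intro mult_nonpos_nonneg) auto
    then show ?thesis using v0 by auto
  next
    case 3
    obtain x where x: "x \<in> {t<..<t0}" "v (2*C) t0 - v (2*C) t = dv (2*C) x * (t0 - t)"
      using real_Icc_mvt_within[OF 3 sub[OF I(3,2)] v'] .
    have "x \<in> I" using x(1) sub[OF I(3,2)] by auto
    then have "0 \<le> 2 * (u x \<bullet> u' x) + (2*C) * (u x \<bullet> u x)"
      using inner_bound[of x] by simp
    then have "0 \<le> v (2*C) t0 - v (2*C) t"
      unfolding x(2) dv_def using 3 by (intro mult_nonneg_nonneg) auto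
    then show ?thesis using v0 by (intro exI[of _ "2*C"]) auto
  qed
  then have "u t \<bullet> u t \<le> 0" by (auto simp: v_def mult_le_0_iff not_le[symmetric])
  then show ?thesis by (metis inner_gt_zero_iff not_less)
qed

text \<open>While a solution stays in a small closed ball its speed is at most \<open>M\<close>, so
  it cannot reach distance \<open>r\<close> in time r/(2M). This time does not depend on the
  solution.\<close>

lemma ivp_solutions_remain_near:
  fixes G :: "'a::real_normed_vector \<Rightarrow> 'a"
  assumes "open N" "x0 \<in> N" and G: "isCont G x0"
  obtains \<alpha>0 where "\<alpha>0 > 0"
    "\<And>\<alpha> w t. \<alpha> \<le> \<alpha>0 \<Longrightarrow> ivp_solution G W t0 x0 {t0 - \<alpha>..t0 + \<alpha>} w \<Longrightarrow>
        t \<in> {t0 - \<alpha>..t0 + \<alpha>} \<Longrightarrow> w t \<in> N"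
proof -
  obtain r1 where r1: "r1 > 0" "ball x0 r1 \<subseteq> N"
    using assms openE by blast
  obtain r2 where r2: "r2 > 0" "\<And>x. dist x x0 < r2 \<Longrightarrow> dist (G x) (G x0) < 1"
    using G[unfolded continuous_at_eps_delta] by (metis zero_less_one)
  define r where "r = min r1 r2 / 2"
  define M where "M = norm (G x0) + 1"
  have M: "M > 0" by (simp add: M_def add_nonneg_pos)
  have r: "r > 0" "cball x0 r \<subseteq> N"
    using r1 r2(1) by (auto simp: r_def subset_iff)
  have GM: "norm (G x) \<le> M" if "x \<in> cball x0 r" for x
  proof -
    have "dist x x0 < r2" using that r1(1) r2(1) by (auto simp: r_def dist_commute)
    then have "dist (G x) (G x0) < 1" using r2 by blast
    moreover have "norm (G x) - norm (G x0) \<le> dist (G x) (G x0)"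
      unfolding dist_norm by (rule norm_triangle_ineq2)
    ultimately show ?thesis unfolding M_def by linarith
  qed
  show ?thesis
  proof (rule that[of "r / (2 * M)"])
    show "r / (2 * M) > 0" using r M by simp
    fix \<alpha> w t
    assume \<alpha>: "\<alpha> \<le> r / (2 * M)" and t: "t \<in> {t0 - \<alpha>..t0 + \<alpha>}"
      and sol: "ivp_solution G W t0 x0 {t0 - \<alpha>..t0 + \<alpha>} w"
    define I where "I = {t0 - \<alpha>..t0 + \<alpha>}"
    have der: "(w has_vector_derivative G (w t)) (at t within I)" if "t \<in> I" for t
      using sol that by (simp add: I_def ivp_solution_def)
    have wt0: "w t0 = x0" using sol by (simp add: ivp_solution_def)
    have cont: "continuous_on I w"
      using der by (meson continuous_on_eq_continuous_within has_vector_derivative_continuous)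
    have t0: "t0 \<in> I" using t by (auto simp: I_def)
    have conv: "convex I" by (simp add: I_def)
    \<comment> \<open>The times at which the solution is at distance at least \<open>r\<close>. This
      set is compact, so a time in it closest to \<open>t0\<close> exists; using the distance to
      \<open>t0\<close> treats both time directions together.\<close>
    define A where "A = {\<tau>\<in>I. r \<le> dist (w \<tau>) x0}"
    have "A = {}"
    proof (rule ccontr)
      assume "A \<noteq> {}"
      have contd: "continuous_on I (\<lambda>\<tau>. dist (w \<tau>) x0)"
        by (intro continuous_intros cont)
      have "compact A"
      proof -
        have "closed A"
          unfolding A_def using continuous_on_closed_Collect_le[OF _ contd, of "\<lambda>_. r"]
          by (simp add: I_def)
        moreover have "bounded A" by (rule bounded_subset[of I]) (auto simp: A_def I_def)
        ultimately show ?thesis by (simp add: compact_eq_bounded_closed)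
      qed
      then obtain \<tau> where \<tau>: "\<tau> \<in> A" "\<And>s. s \<in> A \<Longrightarrow> dist t0 \<tau> \<le> dist t0 s"
        using \<open>A \<noteq> {}\<close> distance_attains_inf[of A t0] compact_imp_closed by blast
      define S where "S = closed_segment t0 \<tau>"
      have S: "S \<subseteq> I"
        unfolding S_def using \<tau>(1) t0 conv by (intro closed_segment_subset) (auto simp: A_def)
      have eq: "s = \<tau>" if "s \<in> S" "s \<in> A" for s
        using \<tau>(2)[OF that(2)] that(1)
        by (auto simp: S_def closed_segment_eq_real_ivl dist_real_def split: if_splits)
      have S2: "w s \<in> cball x0 r" if "s \<in> S" for s
      proof (cases "s = \<tau>")
        case False
        then show ?thesis using eq[OF that] that S by (force simp: A_def dist_commute)
      next
        \<comment> \<open>At \<tau> itself the distance could exceed \<open>r\<close>. By the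
          intermediate value theorem it equals \<open>r\<close> somewhere on the segment, and
          minimality leaves only \<tau> for that time.\<close>
        case True
        let ?f = "\<lambda>\<tau>. dist (w \<tau>) x0"
        have "connected (?f ` S)"
          using contd S unfolding S_def
          by (intro connected_continuous_image) (auto intro: continuous_on_subset)
        then have "{?f t0..?f \<tau>} \<subseteq> ?f ` S"
          by (rule connected_contains_Icc) (auto simp: S_def)
        moreover have "r \<in> {?f t0..?f \<tau>}" using \<tau>(1) r wt0 by (auto simp: A_def)
        ultimately have "r \<in> ?f ` S" by (rule subsetD)
        then obtain s' where s': "s' \<in> S" "?f s' = r" by auto
        then have "s' = \<tau>" using S by (intro eq) (auto simp: A_def)
        then show ?thesis using s' True by (auto simp: dist_commute)
      qed
      have "norm (w \<tau> - w t0) \<le> M * norm (\<tau> - t0)"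
      proof (rule vector_differentiable_bound[where S = S])
        show "(w has_vector_derivative G (w s)) (at s within S)" if "s \<in> S" for s
          using der that S by (meson has_vector_derivative_within_subset subsetD)
        show "norm (G (w s)) \<le> M" if "s \<in> S" for s using GM S2 that by blast
      qed (auto simp: S_def)
      also have "\<dots> \<le> M * \<alpha>"
        using \<tau>(1) M by (intro mult_left_mono) (auto simp: A_def I_def)
      also have "\<dots> \<le> M * (r / (2 * M))" using \<alpha> M by (intro mult_left_mono) auto
      also have "\<dots> < r" using M r by simp
      finally show False using \<tau>(1) wt0 by (simp add: A_def dist_norm)
    qed
    then have "dist (w t) x0 < r" using t by (auto simp: A_def I_def)
    then show "w t \<in> N" using r(2) by (auto simp: dist_commute subset_iff)
  qed
qed

section \<open>Solvability of the two reduced equations\<close>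

text \<open>Banach's fixed point theorem for the integral operator, on bounded continuous functions
  of the whole line with values in the ball. Working on the whole line makes the space complete;
  only the values on the interval matter.\<close>

lemma picard_local_existence:
  fixes H :: "real \<times> 'b::euclidean_space \<Rightarrow> 'b"
  assumes "a > 0" "b > 0"
    and cont: "continuous_on ({-a..a} \<times> cball 0 b) H"
    and lip: "lipschitz_fixing_first ({-a..a} \<times> cball 0 b) H"
  obtains \<delta> Y where "0 < \<delta>" "\<delta> \<le> a" "Y 0 = 0"
    "\<And>s. s \<in> {-\<delta>..\<delta>} \<Longrightarrow> Y s \<in> cball 0 b"
    "\<And>s. s \<in> {-\<delta>..\<delta>} \<Longrightarrow> (Y has_vector_derivative H (s, Y s)) (at s within {-\<delta>..\<delta>})"
proof -
  obtain L where L: "L > 0" and HL: "\<And>s x y. s \<in> {-a..a} \<Longrightarrow> x \<in> cball 0 b \<Longrightarrow> y \<in> cball 0 b \<Longrightarrow>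
      norm (H (s, x) - H (s, y)) \<le> L * norm (x - y)"
    using lip unfolding lipschitz_fixing_first_def by (metis mem_Sigma_iff)
  have "bounded (H ` ({-a..a} \<times> cball 0 b))"
    by (intro compact_imp_bounded compact_continuous_image cont compact_Times) auto
  then obtain M where M: "M > 0" "\<And>s x. s \<in> {-a..a} \<Longrightarrow> x \<in> cball 0 b \<Longrightarrow> norm (H (s, x)) \<le> M"
    unfolding bounded_pos by blast
  \<comment> \<open>The bound b/M keeps the integral curves in the ball, and 1/(2L) gives the
    contraction factor 1/2.\<close>
  define \<delta> where "\<delta> = min a (min (b / M) (1 / (2 * L)))"
  have \<delta>: "\<delta> > 0" "\<delta> \<le> a" using assms M(1) L by (auto simp: \<delta>_def)
  have "\<delta> \<le> b / M" "\<delta> \<le> 1 / (2 * L)" by (auto simp: \<delta>_def)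
  then have \<delta>M: "M * \<delta> \<le> b" and \<delta>L: "L * \<delta> \<le> 1 / 2"
    using M(1) L by (auto simp: field_simps)
  define I where "I = {-\<delta>..\<delta>}"
  have I: "0 \<in> I" "convex I" and Ia: "\<And>s. s \<in> I \<Longrightarrow> s \<in> {-a..a}" and I\<delta>: "\<And>s. s \<in> I \<Longrightarrow> \<bar>s\<bar> \<le> \<delta>"
    using \<delta> by (auto simp: I_def)
  define X :: "(real \<Rightarrow>\<^sub>C 'b) set" where "X = PiC UNIV (\<lambda>_. cball 0 b)"
  have X: "f s \<in> cball 0 b" if "f \<in> X" for f s
    using that by (auto simp: X_def mem_PiC_iff Pi_iff)
  \<comment> \<open>Integrating from the left endpoint and subtracting the value at 0 in
    \<open>P\<close> avoids oriented integrals for negative \<open>s\<close>.\<close>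
  define A where "A f s = integral {-\<delta>..s} (\<lambda>\<tau>. H (\<tau>, f \<tau>))" for f :: "real \<Rightarrow>\<^sub>C 'b" and s
  define P where "P f s = A f s - A f 0" for f s
  have derP: "(P f has_vector_derivative H (s, f s)) (at s within I)" if "f \<in> X" "s \<in> I" for f s
  proof -
    have "continuous_on I (H \<circ> (\<lambda>\<tau>. (\<tau>, f \<tau>)))"
      using X[OF that(1)] Ia
      by (intro continuous_on_compose continuous_on_subset[OF cont] continuous_intros) auto
    then have "(A f has_vector_derivative H (s, f s)) (at s within I)"
      unfolding A_def using integral_has_vector_derivative[of "-\<delta>" \<delta> _ s] that(2)
      by (auto simp: I_def o_def)
    then show ?thesis
      unfolding P_def by (auto intro!: derivative_eq_intros)
  qed
  have P0: "P f 0 = 0" for f by (simp add: P_def)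
  have Pb: "P f s \<in> cball 0 b" if "f \<in> X" "s \<in> I" for f s
  proof -
    have "norm (P f s - P f 0) \<le> M * norm (s - 0)"
      using I derP[OF that(1)] M(2)[OF Ia X[OF that(1)]] that(2)
      by (intro vector_differentiable_bound[where S = I])
    also have "\<dots> \<le> M * \<delta>" using I\<delta>[OF that(2)] M by (intro mult_left_mono) auto
    finally show ?thesis using \<delta>M P0 by simp
  qed
  have clampI: "clamp (-\<delta>) \<delta> s \<in> I" for s
    using clamp_in_interval[of "-\<delta>" \<delta> s] \<delta> by (simp add: I_def)
  \<comment> \<open>Clamping extends \<open>P f\<close> by its endpoint values, which keeps it
    continuous and bounded on the line.\<close>
  define Q where "Q f = Bcontfun (\<lambda>s. P f (clamp (-\<delta>) \<delta> s))" for f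
  have Q: "apply_bcontfun (Q f) = (\<lambda>s. P f (clamp (-\<delta>) \<delta> s))" if "f \<in> X" for f
  proof -
    have "continuous_on I (P f)"
      using derP[OF that] by (meson continuous_on_eq_continuous_within has_vector_derivative_continuous)
    then have "continuous_on UNIV (\<lambda>s. P f (clamp (-\<delta>) \<delta> s))"
      by (intro clamp_continuous_on) (simp add: I_def)
    moreover have "bounded (range (\<lambda>s. P f (clamp (-\<delta>) \<delta> s)))"
      using Pb[OF that clampI] by (intro bounded_subset[OF bounded_cball[of 0 b]]) auto
    ultimately show ?thesis unfolding Q_def by (intro Bcontfun_inverse) (simp add: bcontfun_def)
  qed
  have "\<exists>!f\<in>X. Q f = f"
  proof (rule Banach_fix[of X "1/2"])
    show "complete X"
      unfolding X_def complete_eq_closed by (intro closed_PiC) auto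
    show "X \<noteq> {}"
    proof -
      have "const_bcontfun 0 \<in> X"
        using assms(2) by (simp add: X_def mem_PiC_iff Pi_iff const_bcontfun.rep_eq)
      then show ?thesis by blast
    qed
    show "Q ` X \<subseteq> X"
      using Pb clampI by (auto simp: X_def[symmetric] Q) (auto simp: X_def mem_PiC_iff Pi_iff Q[unfolded X_def])
    show "dist (Q f) (Q h) \<le> 1/2 * dist f h" if "f \<in> X" "h \<in> X" for f h
    proof (rule dist_bound)
      fix s
      let ?c = "clamp (-\<delta>) \<delta> s" and ?d = "\<lambda>s. P f s - P h s"
      \<comment> \<open>The difference of the two images vanishes at 0, so a bound on its derivative
        replaces an integral estimate.\<close>
      have "norm (?d ?c - ?d 0) \<le> (L * dist f h) * norm (?c - 0)"
      proof (rule vector_differentiable_bound[where S = I])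
        show "(?d has_vector_derivative H (s, f s) - H (s, h s)) (at s within I)" if "s \<in> I" for s
          by (intro has_vector_derivative_diff derP \<open>f \<in> X\<close> \<open>h \<in> X\<close> that)
        show "norm (H (s, f s) - H (s, h s)) \<le> L * dist f h" if "s \<in> I" for s
        proof -
          have "norm (H (s, f s) - H (s, h s)) \<le> L * norm (f s - h s)"
            by (intro HL Ia X \<open>f \<in> X\<close> \<open>h \<in> X\<close> that)
          also have "\<dots> \<le> L * dist f h"
            using dist_bounded[of f s h] L by (intro mult_left_mono) (auto simp: dist_norm)
          finally show ?thesis .
        qed
      qed (use I clampI in auto)
      also have "\<dots> \<le> (L * dist f h) * \<delta>"
        using L I\<delta>[OF clampI] by (intro mult_left_mono) auto
      also have "\<dots> = (L * \<delta>) * dist f h" by simp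
      also have "\<dots> \<le> 1/2 * dist f h" by (intro mult_right_mono \<delta>L) auto
      finally show "dist (Q f s) (Q h s) \<le> 1/2 * dist f h"
        using that by (simp add: Q P0 dist_norm)
    qed
  qed auto
  then obtain f where f: "f \<in> X" "Q f = f" by blast
  have fP: "f s = P f s" if "s \<in> I" for s
  proof -
    have "f s = Q f s" using f by simp
    then show ?thesis using Q[OF f(1)] that by (simp add: I_def)
  qed
  show ?thesis
  proof (rule that[of \<delta> f])
    show "f 0 = 0" using fP I P0 by simp
    show "(f has_vector_derivative H (s, f s)) (at s within {-\<delta>..\<delta>})" if "s \<in> {-\<delta>..\<delta>}" for s
      using derP[OF f(1), of s] that fP unfolding I_def[symmetric]
      by (rule_tac has_vector_derivative_transform[of s I "apply_bcontfun f" "P f"]) auto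
  qed (use \<delta> X f in auto)
qed

text \<open>The constant \<open>e\<close> only records the sign of \<open>\<gamma>\<close>.  An antiderivative \<open>T\<close> of \<open>e / \<gamma>\<close>
  linearises \<open>s' = \<gamma>(s)\<close>: along every solution \<open>T(s(t))\<close> has derivative \<open>e\<close>.\<close>

lemma autonomous_scalar_ivp:
  fixes \<gamma> :: "real \<Rightarrow> real"
  assumes "\<delta> > 0" and cont: "continuous_on {-\<delta>..\<delta>} \<gamma>"
    and e: "\<And>s. s \<in> {-\<delta>..\<delta>} \<Longrightarrow> e * \<gamma> s > 0"
  obtains \<beta> where "\<beta> > 0"
    "\<And>\<alpha> t0. 0 < \<alpha> \<Longrightarrow> \<alpha> < \<beta> \<Longrightarrow> has_unique_ivp_solution \<gamma> {-\<delta>..\<delta>} t0 0 {t0 - \<alpha>..t0 + \<alpha>}"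
proof -
  define D where "D = {-\<delta>..\<delta>}"
  have D: "0 \<in> D" "convex D" "compact D" using assms by (auto simp: D_def)
  have nz: "\<gamma> s \<noteq> 0" if "s \<in> D" for s using e[of s] that by (auto simp: D_def)
  have e0: "e \<noteq> 0" using e[of 0] D by (auto simp: D_def)
  have "continuous_on D (\<lambda>s. e / \<gamma> s)"
    using nz cont unfolding D_def by (intro continuous_intros) auto
  then obtain T0 where T0: "\<And>s. s \<in> D \<Longrightarrow> (T0 has_vector_derivative e / \<gamma> s) (at s within D)"
    using antiderivative_continuous unfolding D_def by metis
  define T where "T s = T0 s - T0 0" for s
  have T: "(T has_real_derivative e / \<gamma> s) (at s within D)" if "s \<in> D" for s
    unfolding T_def using T0[OF that]
    by (auto intro!: derivative_eq_intros simp: has_real_derivative_iff_has_vector_derivative[symmetric])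
  have T_pos: "e / \<gamma> s > 0" if "s \<in> D" for s
    using e that by (force simp: D_def zero_less_mult_iff zero_less_divide_iff)
  have T_zero: "T 0 = 0" by (simp add: T_def)
  have T_less: "T s < T s'" if "s \<in> D" "s' \<in> D" "s < s'" for s s'
  proof -
    have "{s..s'} \<subseteq> D" using that by (auto simp: D_def)
    from real_Icc_mvt_within[OF that(3) this T] obtain x where
      "x \<in> {s<..<s'}" "T s' - T s = e / \<gamma> x * (s' - s)" by blast
    moreover from this have "e / \<gamma> x > 0" using that by (intro T_pos) (auto simp: D_def)
    ultimately have "0 < T s' - T s" using that(3) mult_pos_pos[of "e / \<gamma> x" "s' - s"] by linarith
    then show ?thesis by simp
  qed
  have T_inj: "inj_on T D" by (rule linorder_inj_onI) (use T_less in force)+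
  have T_cont: "continuous_on D T"
    using T by (meson DERIV_continuous continuous_on_eq_continuous_within)
  \<comment> \<open>Since T(s(t)) = e (t - t0) along a solution, the inverse of \<open>T\<close>
    gives the solution explicitly.\<close>
  define \<sigma> where "\<sigma> = the_inv_into D T"
  have \<sigma>T: "\<sigma> (T s) = s" if "s \<in> D" for s
    using T_inj that by (simp add: \<sigma>_def the_inv_into_f_f)
  have \<sigma>_cont: "continuous_on (T ` D) \<sigma>"
    unfolding \<sigma>_def by (rule continuous_on_inv_into[OF T_cont D(3) T_inj])
  define \<beta> where "\<beta> = min (T \<delta>) (- T (-\<delta>))"
  have \<beta>: "\<beta> > 0" using T_less[of 0 \<delta>] T_less[of "-\<delta>" 0] T_zero assms(1) by (auto simp: \<beta>_def D_def)
  have range: "\<tau> \<in> T ` D" if "\<bar>\<tau>\<bar> < \<beta>" for \<tau>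
  proof -
    have "{T (-\<delta>)..T \<delta>} \<subseteq> T ` D"
      using assms(1) by (intro connected_contains_Icc connected_continuous_image T_cont) (auto simp: D_def)
    moreover have "\<tau> \<in> {T (-\<delta>)..T \<delta>}" using that by (auto simp: \<beta>_def)
    ultimately show ?thesis by blast
  qed
  \<comment> \<open>Strict interiority makes the derivative of \<open>T\<close> at
    \<open>\<sigma> \<tau>\<close> two-sided, as the inverse function rule requires.\<close>
  have \<sigma>D: "\<sigma> \<tau> \<in> {-\<delta><..<\<delta>}" and T\<sigma>: "T (\<sigma> \<tau>) = \<tau>" if \<tau>: "\<bar>\<tau>\<bar> < \<beta>" for \<tau>
  proof -
    obtain s where s: "s \<in> D" "T s = \<tau>" using range[OF \<tau>] by blast
    then show "T (\<sigma> \<tau>) = \<tau>" using \<sigma>T by auto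
    have "s \<noteq> \<delta>" "s \<noteq> -\<delta>" using s(2) \<tau> by (auto simp: \<beta>_def)
    then show "\<sigma> \<tau> \<in> {-\<delta><..<\<delta>}" using s \<sigma>T by (auto simp: D_def)
  qed
  have \<sigma>': "(\<sigma> has_real_derivative \<gamma> (\<sigma> \<tau>) / e) (at \<tau>)" if "\<bar>\<tau>\<bar> < \<beta>" for \<tau>
  proof -
    have s: "\<sigma> \<tau> \<in> {-\<delta><..<\<delta>}" "\<sigma> \<tau> \<in> D" using \<sigma>D[OF that] by (auto simp: D_def)
    have "at (\<sigma> \<tau>) within D = at (\<sigma> \<tau>)"
      using s(1) by (intro at_within_open_subset[of _ "{-\<delta><..<\<delta>}"]) (auto simp: D_def)
    then have "DERIV T (\<sigma> \<tau>) :> e / \<gamma> (\<sigma> \<tau>)" using T[OF s(2)] by simp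
    then have "DERIV \<sigma> \<tau> :> inverse (e / \<gamma> (\<sigma> \<tau>))"
    proof (rule DERIV_inverse_function[where a = "-\<beta>" and b = \<beta>])
      have "continuous_on {-\<beta><..<\<beta>} \<sigma>"
        using range by (intro continuous_on_subset[OF \<sigma>_cont]) (auto simp: abs_less_iff)
      then show "isCont \<sigma> \<tau>"
        using that by (subst (asm) continuous_on_eq_continuous_at) (auto simp: abs_less_iff)
    qed (use that T\<sigma> nz s e0 in \<open>auto simp: abs_less_iff\<close>)
    then show ?thesis by (simp add: inverse_eq_divide)
  qed
  show ?thesis
  proof (rule that[of "\<beta> / \<bar>e\<bar>"])
    show "\<beta> / \<bar>e\<bar> > 0" using \<beta> e0 by simp
    fix \<alpha> t0 :: real assume \<alpha>: "0 < \<alpha>" "\<alpha> < \<beta> / \<bar>e\<bar>"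
    define I where "I = {t0 - \<alpha>..t0 + \<alpha>}"
    have small: "\<bar>e * (t - t0)\<bar> < \<beta>" if "t \<in> I" for t
    proof -
      have "\<bar>e\<bar> * \<bar>t - t0\<bar> \<le> \<bar>e\<bar> * \<alpha>"
        using that by (intro mult_left_mono) (auto simp: I_def)
      also have "\<dots> < \<beta>" using \<alpha>(2) e0 by (simp add: field_simps)
      finally show ?thesis by (simp add: abs_mult)
    qed
    define z where "z t = \<sigma> (e * (t - t0))" for t
    have "ivp_solution \<gamma> {-\<delta>..\<delta>} t0 0 I z"
      unfolding ivp_solution_def
    proof (intro conjI ballI)
      show "z t0 = 0" using \<sigma>T[OF D(1)] T_zero by (simp add: z_def)
      fix t assume t: "t \<in> I"
      show "z t \<in> {-\<delta>..\<delta>}" using \<sigma>D[OF small[OF t]] by (auto simp: z_def)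
      have "((\<lambda>t. e * (t - t0)) has_real_derivative e) (at t)"
        by (auto intro!: derivative_eq_intros)
      from DERIV_chain2[OF \<sigma>'[OF small[OF t]] this]
      have "(z has_real_derivative \<gamma> (z t)) (at t)" using e0 by (simp add: z_def[abs_def])
      then show "(z has_vector_derivative \<gamma> (z t)) (at t within I)"
        by (simp add: has_real_derivative_iff_has_vector_derivative has_vector_derivative_at_within)
    qed
    moreover have "w t = z t" if w: "ivp_solution \<gamma> {-\<delta>..\<delta>} t0 0 I w" and t: "t \<in> I" for w t
    proof -
      have wD: "w t \<in> D" and w': "(w has_real_derivative \<gamma> (w t)) (at t within I)" if "t \<in> I" for t
        using w that by (auto simp: ivp_solution_def D_def has_real_derivative_iff_has_vector_derivative)
      have const: "((\<lambda>t. T (w t) - e * (t - t0)) has_vector_derivative 0) (at t within I)" if "t \<in> I" for t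
      proof -
        \<comment> \<open>A competing solution may touch the endpoints of \<open>D\<close>, so
          \<open>T\<close> is differentiated only within the image of \<open>I\<close> under
          \<open>w\<close>.\<close>
        have "(T has_real_derivative e / \<gamma> (w t)) (at (w t) within w ` I)"
          by (rule DERIV_subset[OF T[OF wD[OF that]]]) (use wD in auto)
        from DERIV_image_chain[OF this w'[OF that]]
        have "((\<lambda>t. T (w t)) has_real_derivative e) (at t within I)"
          using nz wD[OF that] by (simp add: o_def)
        then show ?thesis
          unfolding has_real_derivative_iff_has_vector_derivative[symmetric]
          by (auto intro!: derivative_eq_intros)
      qed
      have "T (w t) - e * (t - t0) = 0"
      proof (rule gronwall_zero[OF _ _ t const, where C = 0])
        show "is_interval I" "t0 \<in> I" using \<alpha>(1) by (simp_all add: I_def is_interval_cc)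
        show "T (w t0) - e * (t0 - t0) = 0" using w T_zero by (simp add: ivp_solution_def)
      qed simp_all
      then show ?thesis using \<sigma>T[OF wD[OF t]] by (simp add: z_def)
    qed
    ultimately show "has_unique_ivp_solution \<gamma> {-\<delta>..\<delta>} t0 0 {t0 - \<alpha>..t0 + \<alpha>}"
      unfolding has_unique_ivp_solution_def I_def by blast
  qed
qed

section \<open>The transversal system in straightened coordinates\<close>

text \<open>Uniqueness is obtained by comparing an arbitrary solution \<open>(s, y)\<close> with the curve \<open>Y\<close>
  through \<open>y - Y \<circ> s\<close>, which avoids reparametrising the solution by the inverse of \<open>s\<close>.\<close>

theorem transversal_ivp_unique_solution:
  fixes G :: "real \<times> 'b::euclidean_space \<Rightarrow> real \<times> 'b"
  assumes "open W" and G_cont: "continuous_on W G"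
    and lip: "lipschitz_fixing_first_near_zero W G"
    and transversal: "fst (G 0) \<noteq> 0"
  shows "\<exists>\<alpha>>0. has_unique_ivp_solution G W t0 0 {t0 - \<alpha>..t0 + \<alpha>}"
proof -
  obtain N where N: "open N" "0 \<in> N" "N \<subseteq> W" "lipschitz_fixing_first N G"
    using lip unfolding lipschitz_fixing_first_near_zero_def by blast
  have G0: "isCont G 0" using G_cont \<open>open W\<close> N by (meson continuous_on_eq_continuous_at subsetD)
  define e where "e = fst (G 0)"
  \<comment> \<open>Within distance c = |e|/2 of \<open>e\<close>, the first component of G keeps
    the sign of \<open>e\<close> and has absolute value at least \<open>c\<close>.\<close>
  define c where "c = \<bar>e\<bar> / 2"
  have c: "c > 0" using transversal by (simp add: c_def e_def)
  obtain r1 where r1: "r1 > 0" "ball 0 r1 \<subseteq> N" using N openE by blast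
  obtain r2 where r2: "r2 > 0" "\<And>x. dist x 0 < r2 \<Longrightarrow> dist (G x) (G 0) < c"
    using G0[unfolded continuous_at_eps_delta] c by metis
  \<comment> \<open>A point of the product \<open>B\<close> has norm at most 2a, which is below both
    radii.\<close>
  define a where "a = min r1 r2 / 3"
  \<comment> \<open>One constant bounding both G and the reciprocal of its first component, because
    the product rule takes a common bound.\<close>
  define M where "M = norm (G 0) + c + 1 / c"
  have a: "a > 0" using r1 r2 by (simp add: a_def)
  define B where "B = {-a..a} \<times> (cball 0 a :: 'b set)"
  have B: "norm x < r1" "norm x < r2" if "x \<in> B" for x
  proof -
    have "norm x \<le> \<bar>fst x\<bar> + norm (snd x)" using norm_Pair_le[of "fst x" "snd x"] by simp
    also have "\<dots> \<le> a + a" using that by (intro add_mono) (auto simp: B_def)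
    finally show "norm x < r1" "norm x < r2" using r1(1) r2(1) by (auto simp: a_def)
  qed
  have BN: "B \<subseteq> N" using B r1(2) by auto
  have GB: "dist (G x) (G 0) < c" if "x \<in> B" for x using B[OF that] r2 by simp
  have fstG: "\<bar>fst (G x) - e\<bar> < c" if "x \<in> B" for x
    using GB[OF that] dist_fst_le[of "G x" "G 0"] by (simp add: e_def dist_real_def)
  have fstG_ge: "c \<le> \<bar>fst (G x)\<bar>" and fstG_sgn: "e * fst (G x) > 0" if "x \<in> B" for x
    using fstG[OF that] c by (auto simp: c_def abs_if zero_less_mult_iff split: if_splits)
  have normG: "norm (G x) \<le> M" if "x \<in> B" for x
    using GB[OF that] norm_triangle_ineq2[of "G x" "G 0"] c by (simp add: M_def dist_norm add_increasing2)
  have fst_le: "\<bar>fst (G x)\<bar> \<le> M" and snd_le: "norm (snd (G x)) \<le> M" if "x \<in> B" for x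
    using normG[OF that] norm_fst_le[of "fst (G x)" "snd (G x)"] norm_snd_le[of "snd (G x)" "fst (G x)"] by auto
  have inv_le: "\<bar>inverse (fst (G x))\<bar> \<le> M" if "x \<in> B" for x
  proof -
    have "\<bar>inverse (fst (G x))\<bar> \<le> 1 / c"
      using le_imp_inverse_le[OF fstG_ge[OF that] c] by (simp add: inverse_eq_divide)
    also have "\<dots> \<le> M" unfolding M_def using c by simp
    finally show ?thesis .
  qed
  define H where "H x = inverse (fst (G x)) *\<^sub>R snd (G x)" for x
  have G_contB: "continuous_on B G" using G_cont BN N(3) by (meson continuous_on_subset)
  have H_cont: "continuous_on B H"
    unfolding H_def using G_contB fstG_ge c
    by (intro continuous_intros) force+
  have G_lipB: "lipschitz_fixing_first B G" using lipschitz_fixing_first_subset[OF N(4) BN] .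
  have H_lip: "lipschitz_fixing_first B H"
    unfolding H_def
    by (intro lipschitz_fixing_first_bilinear[OF bounded_bilinear_scaleR, where M = M]
        lipschitz_fixing_first_inverse[OF _ c] lipschitz_fixing_first_linear[OF G_lipB]
        bounded_linear_fst bounded_linear_snd)
       (use fstG_ge inv_le snd_le in auto)
  obtain L where L: "L > 0" and HL: "\<And>s x y. (s, x) \<in> B \<Longrightarrow> (s, y) \<in> B \<Longrightarrow> norm (H (s, x) - H (s, y)) \<le> L * norm (x - y)"
    using H_lip unfolding lipschitz_fixing_first_def by metis
  obtain \<delta> Y where \<delta>: "0 < \<delta>" "\<delta> \<le> a" and Y0: "Y 0 = 0"
    and Ya: "\<And>s. s \<in> {-\<delta>..\<delta>} \<Longrightarrow> Y s \<in> cball 0 a"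
    and Y': "\<And>s. s \<in> {-\<delta>..\<delta>} \<Longrightarrow> (Y has_vector_derivative H (s, Y s)) (at s within {-\<delta>..\<delta>})"
    using picard_local_existence[OF a a H_cont[unfolded B_def] H_lip[unfolded B_def]] by blast
  define D where "D = {-\<delta>..\<delta>}"
  have YB: "(s, Y s) \<in> B" if "s \<in> D" for s using that \<delta> Ya by (auto simp: B_def D_def)
  have Y_cont: "continuous_on D Y"
    using Y' unfolding D_def by (meson continuous_on_eq_continuous_within has_vector_derivative_continuous)
  define \<gamma> where "\<gamma> s = fst (G (s, Y s))" for s
  have \<gamma>_cont: "continuous_on D \<gamma>"
    unfolding \<gamma>_def using YB
    by (intro continuous_intros continuous_on_compose2[OF G_contB] Y_cont) auto
  obtain \<beta> where \<beta>: "\<beta> > 0"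
    and scalar: "\<And>\<alpha> t0. 0 < \<alpha> \<Longrightarrow> \<alpha> < \<beta> \<Longrightarrow> has_unique_ivp_solution \<gamma> D t0 0 {t0 - \<alpha>..t0 + \<alpha>}"
    using autonomous_scalar_ivp[OF \<delta>(1) \<gamma>_cont[unfolded D_def], of e] fstG_sgn YB
    unfolding D_def \<gamma>_def by blast
  \<comment> \<open>The radius is \<delta> so that the first coordinate of any solution stays in
    \<open>D\<close>, where \<open>Y\<close> is known to solve its equation.\<close>
  obtain \<alpha>0 where \<alpha>0: "\<alpha>0 > 0"
    and near: "\<And>\<alpha> w t. \<alpha> \<le> \<alpha>0 \<Longrightarrow> ivp_solution G W t0 0 {t0 - \<alpha>..t0 + \<alpha>} w \<Longrightarrow>
        t \<in> {t0 - \<alpha>..t0 + \<alpha>} \<Longrightarrow> w t \<in> ball 0 \<delta>"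
    using ivp_solutions_remain_near[where N = "ball 0 \<delta>" and W = W and ?t0.0 = t0, OF open_ball _ G0] \<delta>(1)
    by (auto simp only: centre_in_ball)
  define \<alpha> where "\<alpha> = min \<alpha>0 (\<beta> / 2)"
  have \<alpha>: "\<alpha> > 0" "\<alpha> \<le> \<alpha>0" "\<alpha> < \<beta>" using \<alpha>0 \<beta> by (auto simp: \<alpha>_def)
  define I where "I = {t0 - \<alpha>..t0 + \<alpha>}"
  have I: "is_interval I" "t0 \<in> I" using \<alpha> by (auto simp: I_def is_interval_cc)
  obtain \<sigma> where \<sigma>: "ivp_solution \<gamma> D t0 0 I \<sigma>"
    and \<sigma>_unique: "\<forall>s. ivp_solution \<gamma> D t0 0 I s \<longrightarrow> (\<forall>t\<in>I. s t = \<sigma> t)"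
    using scalar[OF \<alpha>(1,3), of t0] unfolding has_unique_ivp_solution_def I_def by blast
  have chain: "((\<lambda>t. Y (s t)) has_vector_derivative s' *\<^sub>R H (s t, Y (s t))) (at t within I)"
    if "s ` I \<subseteq> D" "t \<in> I" "(s has_vector_derivative s') (at t within I)" for s s' t
  proof -
    have "(Y has_vector_derivative H (s t, Y (s t))) (at (s t) within s ` I)"
      using that by (intro has_vector_derivative_within_subset[OF Y'[of "s t"]]) (auto simp: D_def)
    from vector_diff_chain_within[OF that(3) this] show ?thesis by (simp add: o_def)
  qed
  have fst_H: "fst (G x) *\<^sub>R H x = snd (G x)" if "x \<in> B" for x
    using fstG_ge[OF that] c by (simp add: H_def)
  define z where "z t = (\<sigma> t, Y (\<sigma> t))" for t
  have "ivp_solution G W t0 0 I z"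
    unfolding ivp_solution_def
  proof (intro conjI ballI)
    show "z t0 = 0" using \<sigma> Y0 by (simp add: z_def ivp_solution_def zero_prod_def)
    fix t assume t: "t \<in> I"
    have \<sigma>D: "\<sigma> ` I \<subseteq> D" and \<sigma>': "(\<sigma> has_vector_derivative \<gamma> (\<sigma> t)) (at t within I)"
      using \<sigma> t by (auto simp: ivp_solution_def)
    then have zB: "z t \<in> B" using t YB by (auto simp: z_def)
    then show "z t \<in> W" using BN N by auto
    have "(z has_vector_derivative (\<gamma> (\<sigma> t), \<gamma> (\<sigma> t) *\<^sub>R H (z t))) (at t within I)"
      unfolding z_def by (intro has_vector_derivative_Pair \<sigma>' chain \<sigma>D t)
    moreover have "\<gamma> (\<sigma> t) = fst (G (z t))" by (simp add: \<gamma>_def z_def)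
    ultimately show "(z has_vector_derivative G (z t)) (at t within I)"
      using fst_H[OF zB] by simp
  qed
  moreover have "w t = z t" if w: "ivp_solution G W t0 0 I w" and t: "t \<in> I" for w t
  proof -
    define s where "s t = fst (w t)" for t
    define y where "y t = snd (w t)" for t
    have w_eq: "w t = (s t, y t)" for t by (simp add: s_def y_def)
    have w': "(w has_vector_derivative G (w t)) (at t within I)" and w0: "w t0 = 0" if "t \<in> I" for t
      using w that by (auto simp: ivp_solution_def)
    have s': "(s has_vector_derivative fst (G (w t))) (at t within I)"
      and y': "(y has_vector_derivative snd (G (w t))) (at t within I)" if "t \<in> I" for t
      unfolding s_def y_def
      using bounded_linear.has_vector_derivative[OF bounded_linear_fst w'[OF that]]
        bounded_linear.has_vector_derivative[OF bounded_linear_snd w'[OF that]] by auto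
    have wn: "norm (w t) < \<delta>" if "t \<in> I" for t
      using near[OF \<alpha>(2) w[unfolded I_def]] that by (simp add: I_def)
    have sD: "s t \<in> D" and wB: "w t \<in> B" if "t \<in> I" for t
      using wn[OF that] norm_fst_le[of "s t" "y t"] norm_snd_le[of "y t" "s t"] \<delta>
      by (auto simp: D_def B_def w_eq)
    \<comment> \<open>The derivative of the difference is the first component of G(w) times
      \<open>H (s, y) - H (s, Y s)\<close>. Both arguments share the first coordinate, so the
      Lipschitz condition with fixed first variable suffices.\<close>
    have "y t - Y (s t) = 0" if "t \<in> I" for t
    proof (rule gronwall_zero[OF I that, where C = "M * L"
          and u = "\<lambda>t. y t - Y (s t)" and u' = "\<lambda>t. snd (G (w t)) - fst (G (w t)) *\<^sub>R H (s t, Y (s t))"])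
      fix t assume t: "t \<in> I"
      show "((\<lambda>t. y t - Y (s t)) has_vector_derivative
          snd (G (w t)) - fst (G (w t)) *\<^sub>R H (s t, Y (s t))) (at t within I)"
        by (intro has_vector_derivative_diff y' s' chain t) (use sD in auto)
      have "norm (snd (G (w t)) - fst (G (w t)) *\<^sub>R H (s t, Y (s t)))
          = \<bar>fst (G (w t))\<bar> * norm (H (w t) - H (s t, Y (s t)))"
        unfolding fst_H[OF wB[OF t], symmetric] scaleR_diff_right[symmetric] by simp
      also have "\<dots> \<le> M * (L * norm (y t - Y (s t)))"
        using fst_le[OF wB[OF t]] HL[of "s t" "y t" "Y (s t)"] wB[OF t] YB[OF sD[OF t]]
        by (intro mult_mono) (auto simp: w_eq[of t])
      finally show "norm (snd (G (w t)) - fst (G (w t)) *\<^sub>R H (s t, Y (s t))) \<le> M * L * norm (y t - Y (s t))"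
        by simp
    next
      show "y t0 - Y (s t0) = 0" using w0[OF I(2)] Y0 by (simp add: y_def s_def)
    qed
    then have yY: "y t = Y (s t)" if "t \<in> I" for t using that by simp
    \<comment> \<open>Now that the solution is known to lie on the graph of \<open>Y\<close>, its
      first coordinate satisfies the scalar equation, whose uniqueness finishes the
      comparison.\<close>
    have "ivp_solution \<gamma> D t0 0 I s"
      unfolding ivp_solution_def
      using w0[OF I(2)] sD s' by (auto simp: \<gamma>_def yY[symmetric] w_eq[symmetric]) (simp add: s_def)
    then have "s t = \<sigma> t" using \<sigma>_unique t by blast
    then show ?thesis using yY[OF t] by (simp add: w_eq z_def)
  qed
  ultimately show ?thesis
    using \<alpha>(1) unfolding has_unique_ivp_solution_def I_def by blast
qed

section \<open>Return to the original coordinates\<close>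

theorem theorem2p3:
  fixes U :: "(real^'m) set" and V :: "(real^'n) set" and J :: "real set"
    and p0 :: "real^'m" and t0 :: real
    and F :: "real^'m \<Rightarrow> real^'m" and g :: "real \<Rightarrow> real^'n \<Rightarrow> real^'m"
  assumes dim: "CARD('m) = CARD('n) + 1"
    and "open U" and "open V" and "p0 \<in> U"
    and F_cont: "continuous_on U F"
    and foliation: "local_foliation g J V U p0"
    and C1: "gradient (\<lambda>z. fst (inv_into (J \<times> V) (foliation_map g) z)) p0 \<bullet> F p0 \<noteq> 0"
    and C2_F: "lipschitz_fixing_first_near_zero (J \<times> V) (F \<circ> foliation_map g)"
    and C2_jac: "lipschitz_fixing_first_near_zero (J \<times> V)
                   (\<lambda>x. matrix_inv (jacobian_matrix (foliation_map g) x))"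
  shows "\<exists>\<alpha>>0. has_unique_ivp_solution F U t0 p0 {t0 - \<alpha>..t0 + \<alpha>}"
proof -
  define W where "W = J \<times> V"
  define \<phi> where "\<phi> = foliation_map g"
  define \<psi> where "\<psi> = inv_into W \<phi>"
  have diffeo: "C1_diffeomorphism W U \<phi>" and "open W" and "0 \<in> W" and \<phi>0: "\<phi> 0 = p0"
    using foliation
    by (auto simp: local_foliation_def W_def \<phi>_def foliation_map_def zero_prod_def open_Times)
  then have bij: "bij_betw \<phi> W U" by (simp add: C1_diffeomorphism_def)
  have \<phi>U: "\<phi> x \<in> U" and \<psi>\<phi>: "\<psi> (\<phi> x) = x" if "x \<in> W" for x
    using bij that by (auto simp: \<psi>_def bij_betw_def)
  have \<psi>W: "\<psi> p \<in> W" and \<phi>\<psi>: "\<phi> (\<psi> p) = p" if "p \<in> U" for p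
    using bij that unfolding \<psi>_def by (auto simp: bij_betw_def intro: inv_into_into f_inv_into_f)
  obtain \<phi>' where \<phi>': "\<And>x. x \<in> W \<Longrightarrow> (\<phi> has_derivative blinfun_apply (\<phi>' x)) (at x)"
    using diffeo unfolding C1_diffeomorphism_def C1_on_def by blast
  obtain \<psi>' where \<psi>': "\<And>p. p \<in> U \<Longrightarrow> (\<psi> has_derivative blinfun_apply (\<psi>' p)) (at p)"
    and \<psi>'_cont: "continuous_on U \<psi>'"
    using diffeo unfolding C1_diffeomorphism_def C1_on_def \<psi>_def by blast
  have \<psi>'\<phi>': "\<psi>' (\<phi> x) (\<phi>' x v) = v" if "x \<in> W" for x v
    using left_inverse_derivative[OF \<open>open W\<close> that \<psi>\<phi> \<phi>'[OF that] \<psi>'[OF \<phi>U[OF that]]] .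
  have \<phi>'\<psi>': "\<phi>' x (\<psi>' (\<phi> x) v) = v" if "x \<in> W" for x v
    using left_inverse_derivative[OF \<open>open U\<close> \<phi>U[OF that] \<phi>\<psi> \<psi>'[OF \<phi>U[OF that]]]
      \<phi>'[OF that] \<psi>\<phi>[OF that] by simp
  define R where "R x = matrix_inv (jacobian_matrix \<phi> x)" for x
  have R: "R x = (\<chi> j i. \<psi>' (\<phi> x) (axis i 1) \<bullet> std_basis j)"
    and R_mult: "std_vector (R x *v v) = \<psi>' (\<phi> x) v" if "x \<in> W" for x v
    using matrix_inv_jacobian_matrix[OF \<phi>'[OF that] bounded_linear.linear[OF blinfun.bounded_linear_right] \<psi>'\<phi>'[OF that] \<phi>'\<psi>'[OF that]]
    by (auto simp: R_def)
  have \<phi>_cont: "continuous_on W \<phi>"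
    using \<phi>' by (meson continuous_at_imp_continuous_on has_derivative_continuous)
  have F\<phi>_cont: "continuous_on W (F \<circ> \<phi>)"
    using \<phi>U by (intro continuous_on_compose \<phi>_cont continuous_on_subset[OF F_cont]) auto
  \<comment> \<open>The entries of \<open>R\<close> are coordinates of
    \<open>\<psi>' (\<phi> x)\<close>, so continuity of \<open>\<psi>'\<close> is enough and matrix
    inversion need not be analysed.\<close>
  have R_cont: "continuous_on W R"
  proof -
    have "continuous_on W (\<lambda>x. \<psi>' (\<phi> x))"
      using \<phi>U by (intro continuous_on_compose2[OF \<psi>'_cont \<phi>_cont]) auto
    then have "continuous_on W (\<lambda>x. \<chi> j i. \<psi>' (\<phi> x) (axis i 1) \<bullet> std_basis j)"
      by (intro continuous_on_vec_lambda continuous_intros)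
    then show ?thesis using R by (simp cong: continuous_on_cong)
  qed
  define G where "G x = std_vector (R x *v F (\<phi> x))" for x
  have G: "G x = \<psi>' (\<phi> x) (F (\<phi> x))" if "x \<in> W" for x
    using R_mult[OF that] by (simp add: G_def)
  have G_cont: "continuous_on W G"
    unfolding G_def using bounded_bilinear.continuous_on[OF bounded_bilinear_std_vector_mult R_cont F\<phi>_cont]
    by (simp add: o_def)
  have G_lip: "lipschitz_fixing_first_near_zero W G"
    using lipschitz_fixing_first_near_zero_bilinear[OF bounded_bilinear_std_vector_mult \<open>open W\<close>
        R_cont _ F\<phi>_cont] C2_F C2_jac
    by (simp add: G_def[abs_def] R_def[abs_def] W_def \<phi>_def)
  \<comment> \<open>Since \<open>\<phi> 0 = p0\<close>, the scalar product in the transversality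
    condition is exactly \<open>fst (G 0)\<close>.\<close>
  have "((\<lambda>p. fst (\<psi> p)) has_derivative (\<lambda>v. fst (\<psi>' p0 v))) (at p0)"
    using \<psi>'[OF \<open>p0 \<in> U\<close>] by (rule has_derivative_fst)
  from gradient_inner[OF this] have "fst (G 0) \<noteq> 0"
    using C1[folded W_def \<phi>_def, folded \<psi>_def] G[OF \<open>0 \<in> W\<close>] by (simp add: \<phi>0)
  from transversal_ivp_unique_solution[OF \<open>open W\<close> G_cont G_lip this, of t0]
  obtain \<alpha> x where "\<alpha> > 0" and x: "ivp_solution G W t0 0 {t0 - \<alpha>..t0 + \<alpha>} x"
    and unique: "\<forall>w. ivp_solution G W t0 0 {t0 - \<alpha>..t0 + \<alpha>} w \<longrightarrow>
      (\<forall>t\<in>{t0 - \<alpha>..t0 + \<alpha>}. w t = x t)"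
    unfolding has_unique_ivp_solution_def by blast
  define I where "I = {t0 - \<alpha>..t0 + \<alpha>}"
  have "ivp_solution F U t0 p0 I (\<phi> \<circ> x)"
    using ivp_solution_diffeomorphism[OF x \<phi>' \<phi>U, of F] G \<phi>'\<psi>' by (simp add: \<phi>0 I_def)
  \<comment> \<open>A competing solution is pulled back by \<open>\<psi>\<close>, identified with
    \<open>x\<close>, and recovered by applying \<open>\<phi>\<close>.\<close>
  moreover have "w t = (\<phi> \<circ> x) t" if w: "ivp_solution F U t0 p0 I w" and t: "t \<in> I" for w t
  proof -
    have "ivp_solution G W t0 0 I (\<psi> \<circ> w)"
      using ivp_solution_diffeomorphism[OF w \<psi>' \<psi>W, of G] G \<psi>W \<phi>\<psi> \<psi>\<phi>[OF \<open>0 \<in> W\<close>]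
      by (simp add: \<phi>0)
    then have "(\<psi> \<circ> w) t = x t" using unique t unfolding I_def by blast
    moreover have "w t \<in> U" using w t by (simp add: ivp_solution_def)
    ultimately show ?thesis using \<phi>\<psi> by fastforce
  qed
  ultimately show ?thesis
    using \<open>\<alpha> > 0\<close> unfolding has_unique_ivp_solution_def I_def by blast
qed

end
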